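(* Let $(S,\mathsf{supt})$ be a $\mathsf{supt}$-perfect semigroup with support $X=\mathsf{supt}(S)$, endowed with the semi-Zariski topology $\mathfrak Z_s$. Then for every integer $n\ge 0$: (1) the set $S_{\le n}=\{f\in S:|\mathsf{supt}(f)|\le n\}$ is closed in $(S,\mathfrak Z_s)$; (2) for every $x\in X$ the set $\{f\in S_{\le n}:x\in\mathsf{supt}(f)\}$ is open in $S_{\le n}$ (with the subspace topology inherited from $(S,\mathfrak Z_s)$); (3) the set $S_{=n}=\{f\in S:|\mathsf{supt}(f)|=n\}$ is discrete in $(S,\mathfrak Z_s)$, i.e. it is a discrete space in the subspace topology.
   Context: A $\mathsf{supt}$-semigroup is a pair $(S,\mathsf{supt})$ consisting of a semigroup $S$ and a function $\mathsf{supt}:S\to 2^X$ into the power set of some set $X$ such that for all $f,g\in S$: (1) $\mathsf{supt}(fg)\subset\mathsf{supt}(f)\cup\mathsf{supt}(g)$, and (2) $fg=gf$ whenever $\mathsf{supt}(f)\cap\mathsf{supt}(g)=\emptyset$. The set $\mathsf{supt}(S)=\bigcup_{a\in S}\mathsf{supt}(a)\subset X$ is called the support of $S$. For $F\subset X$ put $S(F)=\{f\in S:\mathsf{supt}(f)\subset F\}$. A $\mathsf{supt}$-semigroup $(S,\mathsf{supt})$ with support $X=\mathsf{supt}(S)$ is $\mathsf{supt}$-finitary if each $f\in S$ has finite support $\mathsf{supt}(f)$ and for each finite $F\subset X$ the set $S(F)$ is finite. It is $\mathsf{supt}$-perfect if it is $\mathsf{supt}$-finitary and $S(F)=\mathsf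 C(S(X\setminus F))$ for every finite $F\subset X$, where for $T\subset S$ the centralizer is $\mathsf C(T)=\{g\in S: fg=gf \text{ for all } f\in T\}$. The semi-Zariski topology $\mathfrak Z_s$ on a semigroup $S$ is the topology generated by the sub-base consisting of the sets $\{x\in S:axb\ne c\}$ and $\{x\in S:axb\ne cxd\}$, where $a,b,c,d\in S^1$ and $S^1=S\cup\{1\}$ is $S$ with an attached external unit $1\notin S$ (so $1x=x1=x$ for all $x\in S^1$). *)

theory Defs
  imports "HOL-Analysis.Analysis"
begin

text \<open>
  The semigroup \<open>S\<close> is an arbitrary type of class \<^class>\<open>semigroup_mult\<close>. The ambient set
  containing the supports is a type; only the subset \<open>supp_total supt\<close>, which is the support
  \<open>X = supt(S)\<close> of \<open>S\<close>, matters.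
\<close>

definition supp_total :: "('a \<Rightarrow> 'x set) \<Rightarrow> 'x set" where
  "supp_total supt = (\<Union>f. supt f)"

definition supp_within :: "('a \<Rightarrow> 'x set) \<Rightarrow> 'x set \<Rightarrow> 'a set" where
  "supp_within supt F = {f. supt f \<subseteq> F}"

definition centralizer :: "'a::semigroup_mult set \<Rightarrow> 'a set" where
  "centralizer T = {g. \<forall>f\<in>T. f * g = g * f}"

locale supt_semigroup =
  fixes supt :: "'a::semigroup_mult \<Rightarrow> 'x set"
  assumes supt_mult: "supt (f * g) \<subseteq> supt f \<union> supt g"
    and supt_disjoint_commute: "supt f \<inter> supt g = {} \<Longrightarrow> f * g = g * f"

locale supt_finitary = supt_semigroup +
  assumes finite_supt: "finite (supt f)"
    and finite_supp_within:
      "\<lbrakk>finite F; F \<subseteq> supp_total supt\<rbrakk> \<Longrightarrow> finite (supp_within supt F)"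

locale supt_perfect = supt_finitary +
  assumes supp_within_eq_centralizer:
    "\<lbrakk>finite F; F \<subseteq> supp_total supt\<rbrakk> \<Longrightarrow>
      supp_within supt F = centralizer (supp_within supt (supp_total supt - F))"

text \<open>
  \<open>S\<^sup>1\<close> is the type \<open>'a option\<close>: \<open>None\<close> is the external unit, which is attached even if
  \<open>S\<close> already has a unit, and \<open>Some\<close> embeds \<open>S\<close>.
\<close>

fun mult1 :: "'a::semigroup_mult option \<Rightarrow> 'a option \<Rightarrow> 'a option" (infixl \<open>\<cdot>\<^sub>1\<close> 70) where
  "None \<cdot>\<^sub>1 y = y"
| "x \<cdot>\<^sub>1 None = x"
| "Some x \<cdot>\<^sub>1 Some y = Some (x * y)"

definition semi_Zariski :: "'a::semigroup_mult topology" where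
  "semi_Zariski = topology_generated_by
     ({{x. a \<cdot>\<^sub>1 Some x \<cdot>\<^sub>1 b \<noteq> c} | a b c. True} \<union>
      {{x. a \<cdot>\<^sub>1 Some x \<cdot>\<^sub>1 b \<noteq> c \<cdot>\<^sub>1 Some x \<cdot>\<^sub>1 d} | a b c d. True})"

text \<open>
  The topology generated by a family has the union of the family as its underlying set. Here
  this is all of \<open>S\<close>, since \<open>c\<close> may be the external unit.
\<close>

lemma topspace_semi_Zariski [simp]:
  "topspace (semi_Zariski :: 'a::semigroup_mult topology) = UNIV"
proof -
  let ?A = "{{x::'a. a \<cdot>\<^sub>1 Some x \<cdot>\<^sub>1 b \<noteq> c} | a b c. True}"
  have "{x::'a. None \<cdot>\<^sub>1 Some x \<cdot>\<^sub>1 None \<noteq> None} \<in> ?A"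
    by (rule CollectI, intro exI conjI TrueI, rule refl)
  moreover have "{x::'a. None \<cdot>\<^sub>1 Some x \<cdot>\<^sub>1 None \<noteq> None} = UNIV"
    by simp
  ultimately have "UNIV \<in> ?A"
    by (simp only:)
  then have "\<Union> (?A \<union> B) = UNIV" for B
    by (intro equalityI subset_UNIV Union_upper UnI1)
  then show ?thesis
    unfolding semi_Zariski_def topology_generated_by_topspace .
qed

text \<open>
  Finiteness is explicit in the next two definitions because \<^const>\<open>card\<close> is \<open>0\<close> on infinite sets.
\<close>

definition supp_card_le :: "('a \<Rightarrow> 'x set) \<Rightarrow> nat \<Rightarrow> 'a set" where
  "supp_card_le supt n = {f. finite (supt f) \<and> card (supt f) \<le> n}"

definition supp_card_eq :: "('a \<Rightarrow> 'x set) \<Rightarrow> nat \<Rightarrow> 'a set" where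
  "supp_card_eq supt n = {f. finite (supt f) \<and> card (supt f) = n}"

end

theory Submission
  imports Defs
begin

text \<open>
  If \<open>x \<in> supt f\<close> and \<open>F\<close> is a finite set missing \<open>x\<close>, then perfectness yields \<open>g\<close> with support
  disjoint from \<open>F\<close> that does not commute with \<open>f\<close>. The open set of all \<open>h\<close> not commuting with
  \<open>g\<close> contains \<open>f\<close>, and each such \<open>h\<close> has support meeting that of \<open>g\<close>. Choosing successively \<open>k\<close>
  such elements \<open>g\<close>, each with support meeting the previous ones at most in \<open>x\<close>, gives a
  neighbourhood of \<open>f\<close> in which every \<open>h\<close> with \<open>x \<notin> supt h\<close> has at least \<open>k\<close> points in its support.
  Intersecting over \<open>x \<in> supt f\<close>, every \<open>h\<close> near \<open>f\<close> satisfies \<open>supt f \<subseteq> supt h\<close> or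
  \<open>k \<le> |supt h|\<close>; all three claims follow from this, the last one together with the finiteness
  of \<open>S(supt f)\<close> and the closedness of points.
\<close>

lemma openin_semi_Zariski_noncommuting:
  "openin semi_Zariski {h :: 'a::semigroup_mult. h * g \<noteq> g * h}"
proof -
  have "{h. h * g \<noteq> g * h} = {h. None \<cdot>\<^sub>1 Some h \<cdot>\<^sub>1 Some g \<noteq> Some g \<cdot>\<^sub>1 Some h \<cdot>\<^sub>1 None}"
    by simp
  then show ?thesis
    unfolding semi_Zariski_def by (intro topology_generated_by_Basis) blast
qed

lemma openin_semi_Zariski_neq:
  "openin semi_Zariski {h :: 'a::semigroup_mult. h \<noteq> c}"
proof -
  have "{h. h \<noteq> c} = {h. None \<cdot>\<^sub>1 Some h \<cdot>\<^sub>1 None \<noteq> Some c}"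
    by simp
  then show ?thesis
    unfolding semi_Zariski_def by (intro topology_generated_by_Basis) blast
qed

lemma closedin_semi_Zariski_finite:
  assumes "finite (A :: 'a::semigroup_mult set)"
  shows "closedin semi_Zariski A"
proof -
  have "closedin semi_Zariski {c}" for c :: 'a
    using openin_semi_Zariski_neq[of c]
    by (simp add: closedin_def Compl_eq_Diff_UNIV[symmetric] Compl_eq)
  then have "closedin semi_Zariski (\<Union>c\<in>A. {c})"
    using assms by (intro closedin_Union) auto
  then show ?thesis by simp
qed

context supt_perfect
begin

lemma supt_subset_supp_total: "supt f \<subseteq> supp_total supt"
  unfolding supp_total_def by blast

text \<open>The point \<open>x\<close> keeps \<open>f\<close> out of S(F), hence by perfectness out
  of the centralizer of S(X - F).\<close>

lemma noncommuting_disjoint_supt: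
  assumes "x \<in> supt f" "finite F" "x \<notin> F"
  obtains g where "supt g \<inter> F = {}" "f * g \<noteq> g * f"
proof -
  \<comment> \<open>Perfectness concerns only subsets of X; points of \<open>F\<close> outside X lie
    in no support.\<close>
  let ?F = "F \<inter> supp_total supt"
  have "f \<notin> centralizer (supp_within supt (supp_total supt - ?F))"
    using assms supp_within_eq_centralizer[of ?F] by (auto simp: supp_within_def)
  then obtain g where "supt g \<subseteq> supp_total supt - ?F" "f * g \<noteq> g * f"
    unfolding centralizer_def supp_within_def by auto
  then show thesis
    using that by blast
qed

text \<open>Counting only points outside \<open>F\<close> lets the induction on \<open>k\<close>
  enlarge \<open>F\<close>, so that each step finds a point not yet counted.\<close>

lemma nhd_supt_mem_or_card_ge:
  assumes "x \<in> supt f" "finite F" "x \<notin> F"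
  shows "\<exists>U. openin semi_Zariski U \<and> f \<in> U \<and>
           (\<forall>h\<in>U. x \<in> supt h \<or> k \<le> card (supt h - F))"
  using assms(2,3)
proof (induction k arbitrary: F)
  case 0
  show ?case
    using openin_topspace[of semi_Zariski] by auto
next
  case (Suc k)
  obtain g where g: "supt g \<inter> F = {}" "f * g \<noteq> g * f"
    using noncommuting_disjoint_supt[OF assms(1) Suc.prems] .
  \<comment> \<open>The induction hypothesis needs \<open>x\<close> outside the enlarged
    set.\<close>
  let ?F = "F \<union> (supt g - {x})"
  obtain U where U: "openin semi_Zariski U" "f \<in> U"
    "\<And>h. h \<in> U \<Longrightarrow> x \<in> supt h \<or> k \<le> card (supt h - ?F)"
    using Suc.IH[of ?F] Suc.prems finite_supt[of g] by auto
  have "Suc k \<le> card (supt h - F)" if h: "h \<in> U" "h * g \<noteq> g * h" "x \<notin> supt h" for h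
  proof -
    \<comment> \<open>Since \<open>x \<notin> supt h\<close>, this \<open>y\<close> differs from
      \<open>x\<close>; so it lies in \<open>?F\<close> but not in \<open>F\<close>.\<close>
    obtain y where y: "y \<in> supt h" "y \<in> supt g"
      using supt_disjoint_commute[of h g] h(2) by blast
    have "y \<notin> supt h - ?F"
      using y h(3) by blast
    then have "Suc k \<le> card (insert y (supt h - ?F))"
      using U(3)[OF h(1)] h(3) card_insert_disjoint[of "supt h - ?F" y] finite_supt[of h]
      by (metis Suc_le_mono finite_Diff)
    also have "\<dots> \<le> card (supt h - F)"
      using y g(1) finite_supt[of h] by (intro card_mono) auto
    finally show ?thesis .
  qed
  then show ?case
    using U g(2) openin_Int[OF U(1) openin_semi_Zariski_noncommuting[of g]]
    by (intro exI[of _ "U \<inter> {h. h * g \<noteq> g * h}"]) auto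
qed

lemma nhd_supt_superset_or_card_ge:
  "\<exists>U. openin semi_Zariski U \<and> f \<in> U \<and> (\<forall>h\<in>U. supt f \<subseteq> supt h \<or> k \<le> card (supt h))"
proof -
  have "\<exists>U. openin semi_Zariski U \<and> f \<in> U \<and> (\<forall>h\<in>U. x \<in> supt h \<or> k \<le> card (supt h))"
    if "x \<in> supt f" for x
    using nhd_supt_mem_or_card_ge[OF that, of "{}" k] by simp
  then obtain U where U: "\<And>x. x \<in> supt f \<Longrightarrow> openin semi_Zariski (U x) \<and> f \<in> U x \<and>
      (\<forall>h\<in>U x. x \<in> supt h \<or> k \<le> card (supt h))"
    by metis
  show ?thesis
  proof (intro exI[of _ "\<Inter>x\<in>supt f. U x"] conjI ballI)
    show "openin semi_Zariski (\<Inter>x\<in>supt f. U x)"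
      using openin_INT[OF finite_supt, of f semi_Zariski U] U by simp
    show "f \<in> (\<Inter>x\<in>supt f. U x)"
      using U by simp
    show "supt f \<subseteq> supt h \<or> k \<le> card (supt h)" if "h \<in> (\<Inter>x\<in>supt f. U x)" for h
      using U that by auto
  qed
qed

lemma closedin_supp_card_le: "closedin semi_Zariski (supp_card_le supt n)"
proof -
  have "\<exists>U. openin semi_Zariski U \<and> f \<in> U \<and> U \<subseteq> - supp_card_le supt n"
    if f: "f \<in> - supp_card_le supt n" for f
  proof -
    \<comment> \<open>With the threshold \<open>Suc n\<close>, both alternatives give
      \<open>supt h\<close> more than \<open>n\<close> points.\<close>
    obtain U where U: "openin semi_Zariski U" "f \<in> U"
      "\<And>h. h \<in> U \<Longrightarrow> supt f \<subseteq> supt h \<or> Suc n \<le> card (supt h)"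
      using nhd_supt_superset_or_card_ge[of f "Suc n"] by metis
    have "n < card (supt f)"
      using f finite_supt[of f] by (simp add: supp_card_le_def)
    then have "n < card (supt h)" if "h \<in> U" for h
      using U(3)[OF that] card_mono[OF finite_supt, of "supt f" h] by linarith
    then show ?thesis
      using U by (intro exI[of _ U]) (auto simp: supp_card_le_def dest: leD)
  qed
  then have "openin semi_Zariski (- supp_card_le supt n)"
    by (subst openin_subopen) blast
  then show ?thesis
    by (simp add: closedin_def Compl_eq_Diff_UNIV)
qed

lemma openin_supp_card_le_mem_supt:
  "openin (subtopology semi_Zariski (supp_card_le supt n)) {f \<in> supp_card_le supt n. x \<in> supt f}"
proof (subst openin_subopen, intro ballI)
  fix f assume f: "f \<in> {f \<in> supp_card_le supt n. x \<in> supt f}"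
  obtain U where U: "openin semi_Zariski U" "f \<in> U"
    "\<And>h. h \<in> U \<Longrightarrow> supt f \<subseteq> supt h \<or> Suc n \<le> card (supt h)"
    using nhd_supt_superset_or_card_ge[of f "Suc n"] by metis
  \<comment> \<open>Here the bound \<open>n\<close> excludes the second alternative, leaving
    \<open>supt f \<subseteq> supt h\<close>.\<close>
  have "supp_card_le supt n \<inter> U \<subseteq> {f \<in> supp_card_le supt n. x \<in> supt f}"
    using U(3) f by (fastforce simp: supp_card_le_def)
  then show "\<exists>T. openin (subtopology semi_Zariski (supp_card_le supt n)) T \<and> f \<in> T \<and>
      T \<subseteq> {f \<in> supp_card_le supt n. x \<in> supt f}"
    using U f
    by (intro exI[of _ "supp_card_le supt n \<inter> U"]) (auto intro: openin_subtopology_Int2)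
qed

lemma subtopology_supp_card_eq:
  "subtopology semi_Zariski (supp_card_eq supt n) = discrete_topology (supp_card_eq supt n)"
proof -
  have "openin (subtopology semi_Zariski (supp_card_eq supt n)) {f}"
    if f: "f \<in> supp_card_eq supt n" for f
  proof -
    obtain U where U: "openin semi_Zariski U" "f \<in> U"
      "\<And>h. h \<in> U \<Longrightarrow> supt f \<subseteq> supt h \<or> Suc n \<le> card (supt h)"
      using nhd_supt_superset_or_card_ge[of f "Suc n"] by metis
    \<comment> \<open>In \<open>U\<close>, elements with \<open>n\<close> support points have
      support exactly \<open>supt f\<close>, so those other than \<open>f\<close> lie in this finite
      set, which can be removed.\<close>
    let ?A = "supp_within supt (supt f) - {f}"
    have "finite ?A"
      using finite_supp_within[OF finite_supt supt_subset_supp_total] by simp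
    then have "openin semi_Zariski (U - ?A)"
      using U(1) by (intro openin_diff closedin_semi_Zariski_finite)
    moreover have "supp_card_eq supt n \<inter> (U - ?A) = {f}"
    proof -
      have "supt h = supt f" if "h \<in> supp_card_eq supt n" "h \<in> U" for h
        using U(3)[OF that(2)] that f card_subset_eq[of "supt h" "supt f"]
        by (auto simp: supp_card_eq_def)
      then show ?thesis
        using f U(2) unfolding supp_within_def by blast
    qed
    ultimately show ?thesis
      by (metis openin_subtopology_Int2)
  qed
  then have "discrete_topology (supp_card_eq supt n)
      = subtopology semi_Zariski (supp_card_eq supt n)"
    by (subst discrete_topology_unique) simp
  then show ?thesis ..
qed

end

theorem theorem3p2:
  fixes supt :: "'a::semigroup_mult \<Rightarrow> 'x set"
  assumes "supt_perfect supt"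
  shows "\<forall>n::nat.
      closedin semi_Zariski (supp_card_le supt n) \<and>
      (\<forall>x \<in> supp_total supt.
         openin (subtopology semi_Zariski (supp_card_le supt n))
           {f \<in> supp_card_le supt n. x \<in> supt f}) \<and>
      subtopology semi_Zariski (supp_card_eq supt n) = discrete_topology (supp_card_eq supt n)"
proof -
  interpret supt_perfect supt by fact
  show ?thesis
    using closedin_supp_card_le openin_supp_card_le_mem_supt subtopology_supp_card_eq by blast
qed

end
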